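(* Let $n\ge 3$, and consider a system of $n$ robots in the plane with initial positions $R=(r_0,r_1,\ldots,r_{n-1})$. Let $P$ be a pattern of $n$ points, and let $d^*$ be the optimal solution for forming $P$, i.e. $d^*=\min_{A}\max_{0\le i<n} d_i^A$, where the minimum is over all valid strategies $A$. Then in any optimal strategy (a valid strategy $A$ with $\max_i d_i^A=d^*$) at least three robots traverse exactly distance $d^*$.
   Context: A pattern is a finite sequence of distinct points in the plane. Two sequences $P,Q$ of equal length are similar, $P\sim Q$, if some translation, rotation, uniform scaling, and/or reflection of some permutation of $P$ equals $Q$ (entry by entry). A strategy $A$ assigns to each robot $i$ a continuous trajectory $f_i^A(t)$, $t\ge 0$, with $f_i^A(0)=r_i$. It is valid for $P$ if at some time $t$ the sequence of robot positions is similar to $P$; $t(A)$ is the earliest such time. $d_i^A$ is the distance traversed by robot $i$ (the length of its trajectory) from time $0$ to time $t(A)$. *)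

theory Defs
  imports "HOL-Analysis.Analysis" "HOL-Library.Multiset"
begin

text \<open>The plane is the type of complex numbers. A finite sequence of points is a list; the
  \<open>i\<close>-th robot is the index \<open>i < length R\<close> of the list \<open>R\<close> of initial positions.\<close>

definition pattern :: "complex list \<Rightarrow> bool" where
  "pattern P \<longleftrightarrow> distinct P"

text \<open>Rotation by \<open>\<theta>\<close>, scaling by \<open>c\<close> and translation by \<open>b\<close>, possibly after a reflection in the
  real axis; every reflection is one in the real axis followed by a rotation and a translation.
  The scaling factor is nonzero, so a similarity never collapses distinct points.\<close>

definition similarity :: "(complex \<Rightarrow> complex) \<Rightarrow> bool" where
  "similarity T \<longleftrightarrow> (\<exists>b \<theta> c. c > 0 \<and>
     (T = (\<lambda>z. b + complex_of_real c * (cis \<theta> * z)) \<or>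
      T = (\<lambda>z. b + complex_of_real c * (cis \<theta> * cnj z))))"

definition similar :: "complex list \<Rightarrow> complex list \<Rightarrow> bool" where
  "similar P Q \<longleftrightarrow> (\<exists>P' T. mset P' = mset P \<and> similarity T \<and> Q = map T P')"

type_synonym strategy = "nat \<Rightarrow> real \<Rightarrow> complex"

definition is_strategy :: "complex list \<Rightarrow> strategy \<Rightarrow> bool" where
  "is_strategy R A \<longleftrightarrow> (\<forall>i < length R. continuous_on {0..} (A i) \<and> A i 0 = R ! i)"

definition positions :: "nat \<Rightarrow> strategy \<Rightarrow> real \<Rightarrow> complex list" where
  "positions n A t = map (\<lambda>i. A i t) [0..<n]"

definition first_forms :: "complex list \<Rightarrow> strategy \<Rightarrow> real \<Rightarrow> bool" where
  "first_forms P A t \<longleftrightarrow> t \<ge> 0 \<and> similar P (positions (length P) A t) \<and>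
     (\<forall>s. 0 \<le> s \<and> s < t \<longrightarrow> \<not> similar P (positions (length P) A s))"

text \<open>Since scaling factors are nonzero, the times at which the pattern is formed need not be a
  closed set: robots may gather at one point and then expand from it in the shape of the pattern.
  No earliest forming time, and hence no traversed distance, exists for such a strategy; a valid
  strategy is therefore asked to have an earliest forming time.\<close>

definition valid :: "complex list \<Rightarrow> complex list \<Rightarrow> strategy \<Rightarrow> bool" where
  "valid R P A \<longleftrightarrow> is_strategy R A \<and> (\<exists>t. first_forms P A t)"

definition formation_time :: "complex list \<Rightarrow> strategy \<Rightarrow> real" where
  "formation_time P A = (THE t. first_forms P A t)"

text \<open>Supremum of the lengths of inscribed polygonal paths; it is infinite for a curve that is not
  rectifiable.\<close>

definition trajectory_length :: "(real \<Rightarrow> complex) \<Rightarrow> real \<Rightarrow> real \<Rightarrow> ennreal" where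
  "trajectory_length f a b =
     (SUP ts \<in> {ts. sorted ts \<and> set ts \<subseteq> {a..b}}.
        \<Sum>k < length ts - 1. ennreal (dist (f (ts ! k)) (f (ts ! Suc k))))"

definition robot_distance :: "complex list \<Rightarrow> strategy \<Rightarrow> nat \<Rightarrow> ennreal" where
  "robot_distance P A i = trajectory_length (A i) 0 (formation_time P A)"

definition max_distance :: "complex list \<Rightarrow> strategy \<Rightarrow> ennreal" where
  "max_distance P A = (MAX i \<in> {..<length P}. robot_distance P A i)"

text \<open>This infimum is a minimum exactly if an optimal strategy, as defined below, exists.\<close>

definition optimal_distance :: "complex list \<Rightarrow> complex list \<Rightarrow> ennreal" where
  "optimal_distance R P = (INF A \<in> {A. valid R P A}. max_distance P A)"

definition optimal :: "complex list \<Rightarrow> complex list \<Rightarrow> strategy \<Rightarrow> bool" where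
  "optimal R P A \<longleftrightarrow> valid R P A \<and> max_distance P A = optimal_distance R P"

end

theory Submission
  imports Defs
begin

text \<open>Two points of a configuration can be moved to any two distinct points by a complex affine map,
  which is a similarity. If at most two robots had a distance of length \<open>d\<^sup>*\<close> to travel, one could
  pull the targets of these two slightly towards their initial positions and move the other targets
  along by the affine map; they change so little that all distances become smaller than \<open>d\<^sup>*\<close>.

  The new targets are approached by one robot at a time. If all robots moved at once, they could
  gather at one point and expand from it in the shape of the pattern, and no earliest forming time
  would exist. While a single robot moves, at least two others rest and leave only finitely many
  positions in which it completes the pattern, so the set of forming times is closed.\<close>

section \<open>Similarities\<close>

text \<open>By polar form, the products \<open>c * cis \<theta>\<close> with \<open>c > 0\<close>
  are exactly the nonzero complex numbers, so rotation and scaling merge into a single multiplier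
  \<open>w\<close>.\<close>

lemma similarity_iff:
  "similarity T \<longleftrightarrow>
     (\<exists>b w. w \<noteq> 0 \<and> (T = (\<lambda>z. b + w * z) \<or> T = (\<lambda>z. b + w * cnj z)))"
proof
  assume "similarity T"
  then obtain b \<theta> c where c: "c > 0" and
    T: "T = (\<lambda>z. b + complex_of_real c * (cis \<theta> * z)) \<or>
        T = (\<lambda>z. b + complex_of_real c * (cis \<theta> * cnj z))"
    unfolding similarity_def by blast
  have "complex_of_real c * cis \<theta> \<noteq> 0"
    using c by simp
  then show "\<exists>b w. w \<noteq> 0 \<and> (T = (\<lambda>z. b + w * z) \<or> T = (\<lambda>z. b + w * cnj z))"
    using T by (intro exI[of _ b] exI[of _ "complex_of_real c * cis \<theta>"]) (auto simp: mult.assoc)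
next
  assume "\<exists>b w. w \<noteq> 0 \<and> (T = (\<lambda>z. b + w * z) \<or> T = (\<lambda>z. b + w * cnj z))"
  then obtain b w where "w \<noteq> 0" and
    T: "T = (\<lambda>z. b + w * z) \<or> T = (\<lambda>z. b + w * cnj z)"
    by blast
  moreover have w: "w = complex_of_real (cmod w) * cis (Arg w)"
    by (metis rcis_cmod_Arg rcis_def)
  then have "w * z = complex_of_real (cmod w) * (cis (Arg w) * z)" for z
    by (metis mult.assoc)
  ultimately show "similarity T"
    unfolding similarity_def
    by (intro exI[of _ b] exI[of _ "Arg w"] exI[of _ "cmod w"]) auto
qed

lemma similarity_inj:
  assumes "similarity T"
  shows "inj T"
  using assms unfolding similarity_iff inj_def by auto

lemma similarity_affine_comp:
  assumes "similarity T" "w \<noteq> 0"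
  shows "similarity (\<lambda>z. b + w * (T z - a))"
proof -
  obtain b' w' where "w' \<noteq> 0" and
    T: "T = (\<lambda>z. b' + w' * z) \<or> T = (\<lambda>z. b' + w' * cnj z)"
    using assms(1) unfolding similarity_iff by blast
  with assms(2) show ?thesis
    unfolding similarity_iff
    by (intro exI[of _ "b + w * (b' - a)"] exI[of _ "w * w'"])
      (auto simp: algebra_simps)
qed

lemma similar_length:
  assumes "similar P Q"
  shows "length Q = length P"
  using assms unfolding similar_def by (metis length_map mset_eq_length)

lemma similar_distinct:
  assumes "similar P Q" "distinct P"
  shows "distinct Q"
  using assms unfolding similar_def
  by (metis distinct_map inj_on_subset mset_eq_imp_distinct_iff similarity_inj subset_UNIV)

lemma similar_affine:
  assumes "similar P Q" "w \<noteq> 0"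
  shows "similar P (map (\<lambda>z. b + w * (z - a)) Q)"
proof -
  obtain P' T where P': "mset P' = mset P" and T: "similarity T" and Q: "Q = map T P'"
    using assms(1) unfolding similar_def by blast
  have "map (\<lambda>z. b + w * (z - a)) Q = map (\<lambda>z. b + w * (T z - a)) P'"
    unfolding Q by simp
  with P' similarity_affine_comp[OF T assms(2)] show ?thesis
    unfolding similar_def by blast
qed

text \<open>For a fixed arrangement \<open>P'\<close> of the pattern and a fixed orientation, a
  similarity is determined by its values at two distinct points. Two entries of \<open>C\<close>
  other than entry \<open>k\<close> thus leave at most one \<open>z\<close> for each of these
  finitely many choices. Only differences of pattern points are divided by, so entries of
  \<open>C\<close> may coincide.\<close>

lemma finite_completions:
  assumes n: "length P \<ge> 3" and dP: "distinct P" and k: "k < length P"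
    and lC: "length C = length P"
  shows "finite {z. similar P (C[k := z])}"
proof -
  have "card ({..<length P} - {k}) \<ge> 2"
    using n k by simp
  then obtain J where "J \<subseteq> {..<length P} - {k}" "card J = 2"
    by (metis obtain_subset_with_card_n)
  then obtain a b where a: "a < length P" "a \<noteq> k" and b: "b < length P" "b \<noteq> k" and "a \<noteq> b"
    unfolding card_2_iff by blast
  \<comment> \<open>The multiplier that \<open>C ! a\<close> and \<open>C ! b\<close> force on an
    orientation-preserving (\<open>w1\<close>) or orientation-reversing (\<open>w2\<close>)
    similarity.\<close>
  define w1 where "w1 P' = (C ! a - C ! b) / (P' ! a - P' ! b)" for P'
  define w2 where "w2 P' = (C ! a - C ! b) / cnj (P' ! a - P' ! b)" for P'
  define F where "F = {P'. mset P' = mset P}"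
  have "finite F"
    unfolding F_def by (rule finite_subset[OF _ finite_lists_length_eq[of "set P" "length P"]])
      (auto dest: mset_eq_setD mset_eq_length)
  moreover have "{z. similar P (C[k := z])} \<subseteq>
      (\<lambda>P'. C ! a + w1 P' * (P' ! k - P' ! a)) ` F \<union>
      (\<lambda>P'. C ! a + w2 P' * cnj (P' ! k - P' ! a)) ` F"
  proof
    fix z assume "z \<in> {z. similar P (C[k := z])}"
    then obtain P' T where P': "mset P' = mset P" and T: "similarity T" and Q: "C[k := z] = map T P'"
      unfolding similar_def by blast
    have l: "length P' = length P"
      using P' by (rule mset_eq_length)
    have "distinct P'"
      using P' dP by (metis mset_eq_imp_distinct_iff)
    then have ne: "P' ! a \<noteq> P' ! b"
      using a b l \<open>a \<noteq> b\<close> by (simp add: nth_eq_iff_index_eq)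
    have "C[k := z] ! i = T (P' ! i)" if "i < length P" for i
      using that l unfolding Q by simp
    from this[of a] this[of b] this[of k]
    have eq: "C ! a = T (P' ! a)" "C ! b = T (P' ! b)" "z = T (P' ! k)"
      using a b k lC by auto
    obtain c w where "T = (\<lambda>z. c + w * z) \<or> T = (\<lambda>z. c + w * cnj z)"
      using T unfolding similarity_iff by blast
    then show "z \<in> (\<lambda>P'. C ! a + w1 P' * (P' ! k - P' ! a)) ` F \<union>
      (\<lambda>P'. C ! a + w2 P' * cnj (P' ! k - P' ! a)) ` F"
    proof
      assume T: "T = (\<lambda>z. c + w * z)"
      have "C ! a - C ! b = w * (P' ! a - P' ! b)"
        unfolding eq T by (simp add: algebra_simps)
      then have "w1 P' = w"
        using ne unfolding w1_def by simp
      then have "z = C ! a + w1 P' * (P' ! k - P' ! a)"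
        unfolding eq T by (simp add: algebra_simps)
      then show ?thesis
        using P' unfolding F_def by blast
    next
      assume T: "T = (\<lambda>z. c + w * cnj z)"
      have "C ! a - C ! b = w * cnj (P' ! a - P' ! b)"
        unfolding eq T by (simp add: algebra_simps)
      moreover have "cnj (P' ! a - P' ! b) \<noteq> 0"
        using ne by (metis complex_cnj_zero_iff right_minus_eq)
      ultimately have "w2 P' = w"
        unfolding w2_def by (metis nonzero_mult_div_cancel_right)
      then have "z = C ! a + w2 P' * cnj (P' ! k - P' ! a)"
        unfolding eq T by (simp add: algebra_simps)
      then show ?thesis
        using P' unfolding F_def by blast
    qed
  qed
  ultimately show ?thesis
    by (meson finite_UnI finite_imageI finite_subset)
qed

section \<open>Lengths of trajectories\<close>

lemma dist_le_trajectory_length: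
  assumes "a \<le> b"
  shows "ennreal (dist (f a) (f b)) \<le> trajectory_length f a b"
  unfolding trajectory_length_def
  by (rule SUP_upper2[of "[a, b]"]) (use assms in auto)

text \<open>Along a segment traversed monotonically the lengths of the chords add up by telescoping.
  Monotonicity need not be strict, so the robot may rest before and after its move.\<close>

lemma trajectory_length_line_le:
  assumes g: "mono g" and g01: "\<And>t. 0 \<le> g t" "\<And>t. g t \<le> 1"
  shows "trajectory_length (\<lambda>t. r + complex_of_real (g t) * v) a b \<le> ennreal (norm v)"
  unfolding trajectory_length_def
proof (rule SUP_least)
  fix ts assume "ts \<in> {ts. sorted ts \<and> set ts \<subseteq> {a..b}}"
  then have "sorted ts" by simp
  define m where "m = length ts - 1"
  have "dist (r + complex_of_real (g (ts ! k)) * v) (r + complex_of_real (g (ts ! Suc k)) * v)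
      = (g (ts ! Suc k) - g (ts ! k)) * norm v" if "k < m" for k
  proof -
    have "ts ! k \<le> ts ! Suc k"
      using \<open>sorted ts\<close> that unfolding m_def by (intro sorted_nth_mono) auto
    then have "g (ts ! k) \<le> g (ts ! Suc k)"
      using g by (rule monoD[rotated])
    moreover have "dist (r + complex_of_real (g (ts ! k)) * v) (r + complex_of_real (g (ts ! Suc k)) * v)
        = norm (complex_of_real (g (ts ! k) - g (ts ! Suc k)) * v)"
      by (simp add: dist_norm algebra_simps)
    ultimately show ?thesis
      by (simp add: norm_mult del: of_real_diff)
  qed
  then have "(\<Sum>k<m. dist (r + complex_of_real (g (ts ! k)) * v) (r + complex_of_real (g (ts ! Suc k)) * v))
      = (\<Sum>k<m. g (ts ! Suc k) - g (ts ! k)) * norm v"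
    by (simp add: sum_distrib_right)
  also have "\<dots> = (g (ts ! m) - g (ts ! 0)) * norm v"
    by (subst sum_lessThan_telescope[of "\<lambda>k. g (ts ! k)"]) simp
  also have "\<dots> \<le> 1 * norm v"
    using g01(1)[of "ts ! 0"] g01(2)[of "ts ! m"] by (intro mult_right_mono) auto
  finally show "(\<Sum>k<length ts - 1. ennreal (dist (r + complex_of_real (g (ts ! k)) * v)
      (r + complex_of_real (g (ts ! Suc k)) * v))) \<le> ennreal (norm v)"
    unfolding m_def[symmetric] by (simp add: sum_ennreal ennreal_leI)
qed

section \<open>Moving one robot at a time\<close>

text \<open>Clamping \<open>t - real i\<close> to the unit interval makes robot \<open>i\<close>
  move exactly during the time from \<open>i\<close> to \<open>i + 1\<close>; with \<open>n\<close>
  robots the motion is over at time \<open>n\<close>.\<close>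

definition sequential_motion :: "complex list \<Rightarrow> complex list \<Rightarrow> strategy" where
  "sequential_motion R Q i t =
     R ! i + complex_of_real (max 0 (min 1 (t - real i))) * (Q ! i - R ! i)"

lemma continuous_sequential_motion: "continuous_on S (sequential_motion R Q i)"
  unfolding sequential_motion_def by (intro continuous_intros)

lemma trajectory_length_sequential_motion_le:
  "trajectory_length (sequential_motion R Q i) a b \<le> ennreal (dist (R ! i) (Q ! i))"
proof -
  have "trajectory_length (\<lambda>t. R ! i + complex_of_real (max 0 (min 1 (t - real i))) * (Q ! i - R ! i)) a b
      \<le> ennreal (norm (Q ! i - R ! i))"
    by (rule trajectory_length_line_le) (auto simp: mono_def)
  then show ?thesis
    unfolding sequential_motion_def[abs_def] by (simp add: dist_norm norm_minus_commute)
qed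

text \<open>In phase \<open>k\<close> the robots before \<open>k\<close> have arrived and those
  after \<open>k\<close> have not started, so the positions have the form treated in
  \<open>finite_completions\<close>. The phases are closed intervals, which overlap at their
  endpoints.\<close>

lemma positions_sequential_motion:
  assumes "length R = n" "length Q = n" "k < n" "real k \<le> t" "t \<le> real k + 1"
  shows "positions n (sequential_motion R Q) t
    = (take k Q @ drop k R)[k := sequential_motion R Q k t]"
proof (rule nth_equalityI)
  fix i assume "i < length (positions n (sequential_motion R Q) t)"
  then have "i < n"
    by (simp add: positions_def)
  then show "positions n (sequential_motion R Q) t ! i
      = (take k Q @ drop k R)[k := sequential_motion R Q k t] ! i"
  proof (cases i k rule: linorder_cases)
    case less
    then have "real i + 1 \<le> real k" by linarith
    with less assms \<open>i < n\<close> show ?thesis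
      by (simp add: positions_def nth_append sequential_motion_def)
  next
    case greater
    then have "real k + 1 \<le> real i" by linarith
    with greater assms \<open>i < n\<close> show ?thesis
      by (simp add: positions_def nth_append sequential_motion_def)
  qed (use assms in \<open>simp_all add: positions_def\<close>)
qed (use assms in \<open>simp add: positions_def\<close>)

lemma positions_sequential_motion_end:
  assumes "length R = n" "length Q = n"
  shows "positions n (sequential_motion R Q) (real n) = Q"
proof (rule nth_equalityI)
  fix i assume "i < length (positions n (sequential_motion R Q) (real n))"
  then have "i < n"
    by (simp add: positions_def)
  then have "real i + 1 \<le> real n" by linarith
  with \<open>i < n\<close> show "positions n (sequential_motion R Q) (real n) ! i = Q ! i"
    by (simp add: positions_def sequential_motion_def)
qed (use assms in \<open>simp add: positions_def\<close>)

text \<open>The forming times up to \<open>n\<close> are a finite union of preimages of finite sets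
  under continuous maps on closed phases. They form a compact set, nonempty because \<open>Q\<close>
  is reached at time \<open>n\<close>, and its minimum is the earliest forming time.\<close>

lemma first_forms_sequential_motion:
  assumes lR: "length R = length P" and n: "length P \<ge> 3" and dP: "distinct P"
    and PQ: "similar P Q"
  shows "\<exists>t. first_forms P (sequential_motion R Q) t"
proof -
  define n where "n = length P"
  define M where "M = sequential_motion R Q"
  define Z where "Z k = {z. similar P ((take k Q @ drop k R)[k := z])}" for k
  define S where "S = (\<Union>k<n. {t \<in> {real k..real k + 1}. M k t \<in> Z k})"
  have lQ: "length Q = n"
    using similar_length[OF PQ] unfolding n_def .
  have S_iff: "t \<in> S \<longleftrightarrow> similar P (positions n M t)" if "0 \<le> t" "t \<le> real n" for t
  proof -
    have phase: "M k t \<in> Z k \<longleftrightarrow> similar P (positions n M t)"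
      if "k < n" "real k \<le> t" "t \<le> real k + 1" for k
      using positions_sequential_motion[of R n Q k t] that lR lQ
      unfolding Z_def M_def n_def by simp
    \<comment> \<open>The phase is the integer part of \<open>t\<close>, except at
      \<open>t = real n\<close>, where that would be \<open>n\<close>; the last phase
      \<open>n - 1\<close> contains this endpoint.\<close>
    moreover have "\<exists>k<n. real k \<le> t \<and> t \<le> real k + 1"
    proof (cases "t = real n")
      case True
      then show ?thesis
        using n unfolding n_def by (intro exI[of _ "length P - 1"]) auto
    next
      case False
      with that have "nat \<lfloor>t\<rfloor> < n" "real (nat \<lfloor>t\<rfloor>) \<le> t" "t \<le> real (nat \<lfloor>t\<rfloor>) + 1"
        by linarith+
      then show ?thesis by blast
    qed
    ultimately show ?thesis
      unfolding S_def by auto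
  qed
  have "compact {t \<in> {real k..real k + 1}. M k t \<in> Z k}" if "k < n" for k
  proof -
    have "finite (Z k)"
      unfolding Z_def using that n dP lQ lR unfolding n_def by (intro finite_completions) auto
    then have "closed (Z k)"
      by (rule finite_imp_closed)
    then have "closed ({real k..real k + 1} \<inter> M k -` Z k)"
      unfolding M_def
      by (intro continuous_closed_preimage continuous_sequential_motion) auto
    then have "compact ({real k..real k + 1} \<inter> ({real k..real k + 1} \<inter> M k -` Z k))"
      by (intro compact_Int_closed) auto
    also have "{real k..real k + 1} \<inter> ({real k..real k + 1} \<inter> M k -` Z k)
        = {t \<in> {real k..real k + 1}. M k t \<in> Z k}"
      by blast
    finally show ?thesis .
  qed
  then have "compact S"
    unfolding S_def by (intro compact_UN) auto
  moreover have nS: "real n \<in> S"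
    using S_iff[of "real n"] positions_sequential_motion_end[of R n Q] lR lQ PQ
    unfolding M_def n_def by simp
  ultimately obtain t where t: "t \<in> S" "\<And>s. s \<in> S \<Longrightarrow> t \<le> s"
    using compact_attains_inf[of S] by blast
  have "0 \<le> t"
    using t(1) unfolding S_def by force
  have "t \<le> real n"
    using t(2) nS by blast
  \<comment> \<open>Any time before \<open>t\<close> is also at most \<open>n\<close>, so
    \<open>S_iff\<close> covers all earlier times.\<close>
  have "first_forms P M t"
    unfolding first_forms_def n_def[symmetric]
    using S_iff t \<open>0 \<le> t\<close> \<open>t \<le> real n\<close>
    by (metis less_le_not_le order.trans)
  then show ?thesis
    unfolding M_def by blast
qed

text \<open>The sequential motion towards \<open>Q\<close> is a valid strategy. It may form the
  pattern before reaching \<open>Q\<close>, but the length bound holds on every time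
  interval.\<close>

lemma optimal_distance_le:
  assumes lR: "length R = length P" and n: "length P \<ge> 3" and dP: "distinct P"
    and PQ: "similar P Q" and D: "\<And>i. i < length P \<Longrightarrow> dist (R ! i) (Q ! i) \<le> D"
  shows "optimal_distance R P \<le> ennreal D"
proof -
  define M where "M = sequential_motion R Q"
  have "M i 0 = R ! i" for i
    unfolding M_def sequential_motion_def by simp
  then have "valid R P M"
    unfolding valid_def is_strategy_def M_def
    using first_forms_sequential_motion[OF lR n dP PQ]
    by (auto intro: continuous_sequential_motion)
  then have "optimal_distance R P \<le> max_distance P M"
    unfolding optimal_distance_def by (intro INF_lower) simp
  also have "\<dots> \<le> ennreal D"
    unfolding max_distance_def
  proof (rule Max.boundedI)
    fix x assume "x \<in> robot_distance P M ` {..<length P}"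
    then obtain i where i: "i < length P" "x = robot_distance P M i"
      by blast
    have "x \<le> ennreal (dist (R ! i) (Q ! i))"
      unfolding i(2) robot_distance_def M_def by (rule trajectory_length_sequential_motion_le)
    also have "\<dots> \<le> ennreal D"
      using D[OF i(1)] by (rule ennreal_leI)
    finally show "x \<le> ennreal D" .
  next
    show "robot_distance P M ` {..<length P} \<noteq> {}"
      using n by (auto simp: lessThan_empty_iff)
  qed simp
  finally show ?thesis .
qed

section \<open>Perturbing the targets\<close>

lemma first_forms_formation_time:
  assumes "valid R P A"
  shows "first_forms P A (formation_time P A)"
proof -
  obtain t where "first_forms P A t"
    using assms unfolding valid_def by blast
  moreover have "s = t" if "first_forms P A s" "first_forms P A t" for s t
    using that unfolding first_forms_def by (meson linorder_neqE_linordered_idom)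
  ultimately show ?thesis
    unfolding formation_time_def by (metis theI)
qed

text \<open>A complex affine map has two free parameters, enough to prescribe the new targets of
  \<open>a\<close> and \<open>b\<close>. As it tends to the identity, the strict inequalities for
  the other robots persist.\<close>

lemma exists_closer_similar:
  assumes PQ: "similar P Q" and dP: "distinct P" and lR: "length R = length P"
    and ab: "a < length P" "b < length P" "a \<noteq> b"
    and D: "D > 0" "dist (R ! a) (Q ! a) \<le> D" "dist (R ! b) (Q ! b) \<le> D"
    and other: "\<And>i. i < length P \<Longrightarrow> i \<noteq> a \<Longrightarrow> i \<noteq> b \<Longrightarrow> dist (R ! i) (Q ! i) < D"
  shows "\<exists>Q'. similar P Q' \<and> (\<forall>i < length P. dist (R ! i) (Q' ! i) < D)"
proof -
  have lQ: "length Q = length P"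
    using similar_length[OF PQ] .
  have ne: "Q ! a \<noteq> Q ! b"
    using similar_distinct[OF PQ dP] ab lQ by (simp add: nth_eq_iff_index_eq)
  \<comment> \<open>\<open>m i e\<close> is the target of robot \<open>i\<close> pulled back by the
    fraction \<open>e\<close> of its way; \<open>h e\<close> is the affine map, with multiplier
    \<open>w e\<close>, that sends \<open>Q ! a\<close> to \<open>m a e\<close> and
    \<open>Q ! b\<close> to \<open>m b e\<close>.\<close>
  define m where "m i e = Q ! i + complex_of_real e * (R ! i - Q ! i)" for i e
  define w where "w e = (m b e - m a e) / (Q ! b - Q ! a)" for e
  define h where "h e z = m a e + w e * (z - Q ! a)" for e z
  have m0: "m i 0 = Q ! i" for i
    unfolding m_def by simp
  have w0: "w 0 = 1"
    unfolding w_def m0 using ne by simp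
  have ha: "h e (Q ! a) = m a e" for e
    unfolding h_def by simp
  have hb: "h e (Q ! b) = m b e" for e
    unfolding h_def w_def using ne by simp
  have closer: "dist (R ! i) (m i e) < D" if "dist (R ! i) (Q ! i) \<le> D" "0 < e" "e < 1" for i e
  proof -
    have "R ! i - m i e = complex_of_real (1 - e) * (R ! i - Q ! i)"
      unfolding m_def by (simp add: algebra_simps)
    then have "dist (R ! i) (m i e) = (1 - e) * dist (R ! i) (Q ! i)"
      using that by (simp add: dist_norm norm_mult del: of_real_diff)
    also have "\<dots> \<le> (1 - e) * D"
      using that by (intro mult_left_mono) auto
    also have "\<dots> < D"
      using that D(1) by simp
    finally show ?thesis .
  qed
  have m_lim: "(m i \<longlongrightarrow> Q ! i) (at_right 0)" for i
    unfolding m_def by (auto intro!: tendsto_eq_intros)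
  have w_lim: "(w \<longlongrightarrow> 1) (at_right 0)"
    unfolding w_def using ne by (auto intro!: tendsto_eq_intros m_lim)
  have ev_w: "\<forall>\<^sub>F e in at_right 0. w e \<noteq> 0"
    using tendsto_imp_eventually_ne[OF w_lim] by simp
  have h_lim: "((\<lambda>e. dist (R ! i) (h e (Q ! i))) \<longlongrightarrow> dist (R ! i) (Q ! i)) (at_right 0)" for i
    unfolding h_def by (auto intro!: tendsto_eq_intros m_lim w_lim)
  \<comment> \<open>For \<open>a\<close> and \<open>b\<close> a limit argument would fail, since
    their distance may equal \<open>D\<close>; there every \<open>e\<close> strictly between 0 and 1
    gives a strict gain by \<open>closer\<close>.\<close>
  have ev_i: "\<forall>\<^sub>F e in at_right 0. dist (R ! i) (h e (Q ! i)) < D" if "i < length P" for i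
  proof (cases "i = a \<or> i = b")
    case True
    have "\<forall>\<^sub>F e in at_right (0::real). e \<in> {0<..<1}"
      by (rule eventually_at_rightI[of 0 1]) auto
    then show ?thesis
      by eventually_elim (use True closer ha hb D in auto)
  next
    case False
    with other that show ?thesis
      by (intro order_tendstoD(2)[OF h_lim]) auto
  qed
  then have "\<forall>\<^sub>F e in at_right 0. \<forall>i\<in>{..<length P}. dist (R ! i) (h e (Q ! i)) < D"
    by (intro eventually_ball_finite) auto
  with ev_w have "\<forall>\<^sub>F e in at_right 0. w e \<noteq> 0 \<and> (\<forall>i\<in>{..<length P}. dist (R ! i) (h e (Q ! i)) < D)"
    by (rule eventually_conj)
  then obtain e where e: "w e \<noteq> 0" "\<And>i. i < length P \<Longrightarrow> dist (R ! i) (h e (Q ! i)) < D"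
    using eventually_happens'[OF trivial_limit_at_right_real] by fastforce
  have "similar P (map (h e) Q)"
    unfolding h_def using PQ e(1) by (rule similar_affine)
  moreover have "\<forall>i < length P. dist (R ! i) (map (h e) Q ! i) < D"
    using e(2) lQ by simp
  ultimately show ?thesis by blast
qed

text \<open>Fewer than two robots may be extremal, but the affine map is fixed by two distinct
  indices; the set is therefore padded to a pair.\<close>

lemma exists_pair_superset:
  fixes I :: "nat set"
  assumes "I \<subseteq> {..<n}" "card I \<le> 2" "2 \<le> n"
  shows "\<exists>a b. a < n \<and> b < n \<and> a \<noteq> b \<and> I \<subseteq> {a, b}"
proof -
  obtain J where "I \<subseteq> J" "J \<subseteq> {..<n}" "card J = 2"
    using exists_subset_between[of I 2 "{..<n}"] assms by auto
  then show ?thesis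
    unfolding card_2_iff by (metis insert_subset lessThan_iff)
qed

theorem lemma1:
  fixes n :: nat and R P :: "complex list" and A :: strategy
  assumes "n \<ge> 3"
    and "length R = n"
    and "length P = n"
    and "pattern P"
    and "optimal R P A"
  shows "card {i. i < n \<and> robot_distance P A i = optimal_distance R P} \<ge> 3"
proof (rule ccontr)
  define I where "I = {i. i < n \<and> robot_distance P A i = optimal_distance R P}"
  assume "\<not> card {i. i < n \<and> robot_distance P A i = optimal_distance R P} \<ge> 3"
  then have cI: "card I \<le> 2"
    unfolding I_def by simp
  define \<tau> where "\<tau> = formation_time P A"
  define Q where "Q = positions n A \<tau>"
  have dP: "distinct P"
    using assms(4) unfolding pattern_def .
  have vA: "valid R P A" and opt: "max_distance P A = optimal_distance R P"
    using assms(5) unfolding optimal_def by auto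
  have "first_forms P A \<tau>"
    unfolding \<tau>_def using vA by (rule first_forms_formation_time)
  then have "0 \<le> \<tau>" and PQ: "similar P Q"
    unfolding first_forms_def Q_def assms(3) by auto
  have dist_le: "ennreal (dist (R ! i) (Q ! i)) \<le> robot_distance P A i" if "i < n" for i
  proof -
    have "A i 0 = R ! i"
      using vA that assms(2) unfolding valid_def is_strategy_def by simp
    moreover have "Q ! i = A i \<tau>"
      using that unfolding Q_def positions_def by simp
    ultimately show ?thesis
      using dist_le_trajectory_length[OF \<open>0 \<le> \<tau>\<close>, of "A i"]
      unfolding robot_distance_def \<tau>_def by simp
  qed
  have rd_le: "robot_distance P A i \<le> optimal_distance R P" if "i < n" for i
    unfolding opt[symmetric] max_distance_def using that assms(3) by (intro Max_ge) auto
  have le_D: "optimal_distance R P \<le> ennreal D"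
    if "similar P Q'" "\<And>i. i < n \<Longrightarrow> dist (R ! i) (Q' ! i) \<le> D" for Q' D
    using optimal_distance_le[of R P Q' D] that assms dP by simp
  \<comment> \<open>Trajectories may have infinite length, so finiteness of the optimum is not
    automatic. Moving straight to the positions \<open>Q\<close> reached by \<open>A\<close> bounds
    it by the real number \<open>E\<close>.\<close>
  define E where "E = Max ((\<lambda>i. dist (R ! i) (Q ! i)) ` {..<n})"
  have "dist (R ! i) (Q ! i) \<le> E" if "i < n" for i
    unfolding E_def using that by (intro Max_ge) auto
  then have "optimal_distance R P \<le> ennreal E"
    by (rule le_D[OF PQ])
  then have "optimal_distance R P < top"
    by (rule order.strict_trans1) simp
  then obtain D where D: "D \<ge> 0" "optimal_distance R P = ennreal D"
    by (cases "optimal_distance R P") auto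
  \<comment> \<open>If the optimum were 0, every robot would traverse exactly 0 and all
    \<open>n \<ge> 3\<close> of them would lie in \<open>I\<close>.\<close>
  have "D \<noteq> 0"
  proof
    assume "D = 0"
    then have "I = {..<n}"
      using rd_le D unfolding I_def by auto
    with cI assms(1) show False
      by simp
  qed
  with D have "D > 0" by simp
  have "I \<subseteq> {..<n}"
    unfolding I_def by auto
  obtain a b where ab: "a < n" "b < n" "a \<noteq> b" "I \<subseteq> {a, b}"
    using exists_pair_superset[OF \<open>I \<subseteq> {..<n}\<close> cI] assms(1) by auto
  have le: "dist (R ! i) (Q ! i) \<le> D" if "i < n" for i
    using order.trans[OF dist_le[OF that] rd_le[OF that]] D by simp
  have less: "dist (R ! i) (Q ! i) < D" if "i < n" "i \<noteq> a" "i \<noteq> b" for i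
  proof -
    have "i \<notin> I"
      using ab that by auto
    then have "robot_distance P A i < ennreal D"
      using rd_le[OF that(1)] that(1) D unfolding I_def by auto
    with dist_le[OF that(1)] have "ennreal (dist (R ! i) (Q ! i)) < ennreal D"
      by (rule order.strict_trans1)
    then show ?thesis
      by (simp add: ennreal_less_iff)
  qed
  obtain Q' where Q': "similar P Q'" "\<And>i. i < n \<Longrightarrow> dist (R ! i) (Q' ! i) < D"
    using exists_closer_similar[OF PQ dP, of R a b D] ab le less \<open>D > 0\<close> assms by auto
  \<comment> \<open>A maximum over finitely many robots keeps the inequality strict, so
    \<open>D'\<close> is a bound below the optimum \<open>D\<close>.\<close>
  define D' where "D' = Max ((\<lambda>i. dist (R ! i) (Q' ! i)) ` {..<n})"
  have "dist (R ! i) (Q' ! i) \<le> D'" if "i < n" for i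
    unfolding D'_def using that by (intro Max_ge) auto
  then have "ennreal D \<le> ennreal D'"
    using le_D[OF Q'(1)] D(2) by simp
  moreover have "D' < D"
    unfolding D'_def using Q'(2) assms(1) by (subst Max_less_iff) (auto simp: lessThan_empty_iff)
  ultimately show False
    using \<open>D > 0\<close> D(1) by (metis ennreal_lessI not_less)
qed

end
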